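(* Let $(\bm{U}^\star,\bm{\Lambda}^\star)$ be an optimal primal-dual solution pair of the SDP described in the context, let $\bm{X}^\star=\mathcal{A}(\bm{U}^\star)\in\mathbb{S}^N$, fix $K\in\{1,\dots,N-1\}$ and partition $\bm{X}^\star,\bm{\Lambda}^\star\in\mathbb{S}^N$ into blocks as in the context. Then the problem $$\underset{\gamma_1,\gamma_2>0}{\text{minimize}}\quad \frac{\gamma_1}{\gamma_2}\Vert\bm{X}_1^\star\Vert^2+\frac{\gamma_2}{\gamma_1}\Vert\bm{\Lambda}_1^\star\Vert^2+\gamma_1\gamma_2\Vert\bm{X}_2^\star\Vert^2+\frac{1}{\gamma_1\gamma_2}\Vert\bm{\Lambda}_2^\star\Vert^2+2\gamma_1\Vert\bm{X}_0^\star\Vert^2+\frac{2}{\gamma_1}\Vert\bm{\Lambda}_0^\star\Vert^2$$ admits a unique solution pair $(\gamma_1^\star,\gamma_2^\star)$, where $\gamma_2^\star$ is the unique positive real root of the degree-4 polynomial equation $$\gamma_2^4\Vert\bm{X}_2^\star\Vert^2\Vert\bm{\Lambda}_1^\star\Vert^2+\gamma_2^3\big(\Vert\bm{X}_2^\star\Vert^2\Vert\bm{\Lambda}_0^\star\Vert^2+\Vert\bm{X}_0^\star\Vert^2\Vert\bm{\Lambda}_1^\star\Vert^2\big)-\gamma_2\big(\Vert\bm{\Lambda}_2^\star\Vert^2\Vert\bm{X}_0^\star\Vert^2+\Vert\bm{\Lambda}_0^\star\Vert^2\Vert\bm{X}_1^\star\Vert^2\big)-\Vert\bm{\Lambda}_2^\star\Vert^2\Vert\bm{X}_1^\star\Vert^2=0,$$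 and $$\gamma_1^\star=\sqrt{\frac{\gamma_2^\star\Vert\bm{\Lambda}_1^\star\Vert^2+\frac{1}{\gamma_2^\star}\Vert\bm{\Lambda}_2^\star\Vert^2+2\Vert\bm{\Lambda}_0^\star\Vert^2}{\frac{1}{\gamma_2^\star}\Vert\bm{X}_1^\star\Vert^2+\gamma_2^\star\Vert\bm{X}_2^\star\Vert^2+2\Vert\bm{X}_0^\star\Vert^2}} .$$
   Context: $\mathbb{S}^N$ is the space of real symmetric $N\times N$ matrices, $\mathbb{S}^N_+$ the positive semidefinite cone, $\delta_{\mathbb{S}^N_+}$ its indicator function ($0$ on the cone, $+\infty$ off it), $\Vert\cdot\Vert$ the Euclidean (Frobenius) norm. The SDP is: minimize $f(\bm{U})+\delta_{\mathbb{S}^N_+}(\bm{Z})$ over $(\bm{U},\bm{Z})$ subject to $\mathcal{A}(\bm{U})=\bm{Z}$, where, for given $\bm{A}_0,\dots,\bm{A}_m\in\mathbb{S}^N$ and $\bm{c}\in\mathbb{R}^m$, either (primal form) $\bm{U}=\bm{x}\in\mathbb{R}^m$, $f(\bm{x})=\langle\bm{c},\bm{x}\rangle$, $\mathcal{A}(\bm{x})=\bm{A}_0+\sum_{i=1}^m x_i\bm{A}_i$; or (dual form) $\bm{U}\in\mathbb{S}^N$, $f(\bm{U})=\langle\bm{A}_0,\bm{U}\rangle$ with domain $\{\bm{U}\in\mathbb{S}^N:\langle\bm{A}_i,\bm{U}\rangle=c_i,\ i=1,\dots,m\}$ and $\mathcal{A}(\bm{U})=\bm{U}$. A solution is assumed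 to exist; $\bm{\Lambda}^\star\in\mathbb{S}^N$ is an optimal Lagrange multiplier for the constraint $\mathcal{A}(\bm{U})-\bm{Z}=0$ (Lagrangian $f(\bm{U})+\delta_{\mathbb{S}^N_+}(\bm{Z})+\langle\bm{\Lambda},\mathcal{A}(\bm{U})-\bm{Z}\rangle$). Block partition: $\bm{X}=\begin{bmatrix}\bm{X}_1&\bm{X}_0\\ \bm{X}_0^T&\bm{X}_2\end{bmatrix}$, $\bm{\Lambda}=\begin{bmatrix}\bm{\Lambda}_1&\bm{\Lambda}_0\\ \bm{\Lambda}_0^T&\bm{\Lambda}_2\end{bmatrix}$ with $\bm{X}_1,\bm{\Lambda}_1\in\mathbb{S}^K$, $\bm{X}_0,\bm{\Lambda}_0\in\mathbb{R}^{K\times(N-K)}$, $\bm{X}_2,\bm{\Lambda}_2\in\mathbb{S}^{N-K}$.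
   Formalization: The four diagonal blocks X_1*, X_2*, Λ_1*, Λ_2* are additionally assumed nonzero; if any of them vanishes, the minimization problem has no unique solution pair (e.g. X* = diag(1,0), Λ* = diag(0,-1)), so the claim fails. *)

theory Defs
  imports "HOL-Analysis.Analysis" "HOL-Computational_Algebra.Polynomial"
begin

text \<open>
  On \<open>real ^ 'n ^ 'm\<close> the library's \<open>norm\<close> is the Frobenius norm and \<open>\<bullet>\<close> the inner product
  \<open>trace (transpose A ** B)\<close>.
\<close>

definition sym_mats :: "(real ^ 'n ^ 'n) set" where
  "sym_mats = {A. transpose A = A}"

definition psd_cone :: "(real ^ 'n ^ 'n) set" where
  "psd_cone = {A \<in> sym_mats. \<forall>x. 0 \<le> x \<bullet> (A *v x)}"

definition indicator_infty :: "'a set \<Rightarrow> 'a \<Rightarrow> ereal" where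
  "indicator_infty S x = (if x \<in> S then 0 else \<infinity>)"

text \<open>
  The problem: minimize \<open>f U + indicator_infty psd_cone Z\<close> subject to \<open>\<A> U = Z\<close>.
  The domain of \<open>f\<close> is encoded by the value \<open>\<infinity>\<close>.  Letting \<open>Z\<close> range over all square matrices is
  harmless, since the indicator is infinite off the symmetric ones.
\<close>

definition sdp_objective :: "('u \<Rightarrow> ereal) \<Rightarrow> 'u \<times> (real ^ 'n ^ 'n) \<Rightarrow> ereal" where
  "sdp_objective f = (\<lambda>(U, Z). f U + indicator_infty psd_cone Z)"

definition sdp_feasible :: "('u \<Rightarrow> real ^ 'n ^ 'n) \<Rightarrow> 'u \<times> (real ^ 'n ^ 'n) \<Rightarrow> bool" where
  "sdp_feasible \<A> = (\<lambda>(U, Z). \<A> U = Z)"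

definition sdp_lagrangian ::
    "('u \<Rightarrow> ereal) \<Rightarrow> ('u \<Rightarrow> real ^ 'n ^ 'n) \<Rightarrow> real ^ 'n ^ 'n \<Rightarrow> 'u \<times> (real ^ 'n ^ 'n) \<Rightarrow> ereal" where
  "sdp_lagrangian f \<A> \<Lambda> = (\<lambda>(U, Z). f U + indicator_infty psd_cone Z + ereal (\<Lambda> \<bullet> (\<A> U - Z)))"

text \<open>The finiteness condition excludes problems whose objective is identically \<open>\<infinity>\<close> on the
  feasible set.\<close>

definition sdp_solution ::
    "('u \<Rightarrow> ereal) \<Rightarrow> ('u \<Rightarrow> real ^ 'n ^ 'n) \<Rightarrow> 'u \<times> (real ^ 'n ^ 'n) \<Rightarrow> bool" where
  "sdp_solution f \<A> UZ \<longleftrightarrow>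
     is_arg_min (sdp_objective f) (sdp_feasible \<A>) UZ \<and> sdp_objective f UZ < \<infinity>"

text \<open>A multiplier is optimal if the dual function attains the optimal value of the problem at it;
  by weak duality it then maximizes the dual function.\<close>

definition optimal_multiplier ::
    "('u \<Rightarrow> ereal) \<Rightarrow> ('u \<Rightarrow> real ^ 'n ^ 'n) \<Rightarrow> real ^ 'n ^ 'n \<Rightarrow> bool" where
  "optimal_multiplier f \<A> \<Lambda> \<longleftrightarrow>
     \<Lambda> \<in> sym_mats \<and>
     (INF UZ. sdp_lagrangian f \<A> \<Lambda> UZ) = (INF UZ \<in> Collect (sdp_feasible \<A>). sdp_objective f UZ)"

definition primal_dual_pair ::
    "('u \<Rightarrow> ereal) \<Rightarrow> ('u \<Rightarrow> real ^ 'n ^ 'n) \<Rightarrow> 'u \<Rightarrow> real ^ 'n ^ 'n \<Rightarrow> bool" where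
  "primal_dual_pair f \<A> U \<Lambda> \<longleftrightarrow> sdp_solution f \<A> (U, \<A> U) \<and> optimal_multiplier f \<A> \<Lambda>"

definition primal_form_f :: "real ^ 'm \<Rightarrow> real ^ 'm \<Rightarrow> ereal" where
  "primal_form_f c x = ereal (c \<bullet> x)"

definition primal_form_map ::
    "real ^ 'n ^ 'n \<Rightarrow> ('m::finite \<Rightarrow> real ^ 'n ^ 'n) \<Rightarrow> real ^ 'm \<Rightarrow> real ^ 'n ^ 'n" where
  "primal_form_map A0 A x = A0 + (\<Sum>i\<in>UNIV. x $ i *\<^sub>R A i)"

definition dual_form_f ::
    "real ^ 'n ^ 'n \<Rightarrow> ('m::finite \<Rightarrow> real ^ 'n ^ 'n) \<Rightarrow> real ^ 'm \<Rightarrow> real ^ 'n ^ 'n \<Rightarrow> ereal" where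
  "dual_form_f A0 A c U =
     (if U \<in> sym_mats \<and> (\<forall>i. A i \<bullet> U = c $ i) then ereal (A0 \<bullet> U) else \<infinity>)"

definition dual_form_map :: "real ^ 'n ^ 'n \<Rightarrow> real ^ 'n ^ 'n" where
  "dual_form_map U = U"

text \<open>
  A \<open>(K, N - K)\<close> block partition is encoded by the index type \<open>'k + 'l\<close>, where \<open>K = CARD('k)\<close>,
  \<open>N = CARD('k + 'l)\<close> and both parts are nonempty, so that \<open>1 \<le> K \<le> N - 1\<close>.
  The subscripts \<open>1\<close>, \<open>0\<close>, \<open>2\<close> denote the upper left, upper right and lower right block.
\<close>

definition block1 :: "real ^ ('k::finite + 'l::finite) ^ ('k + 'l) \<Rightarrow> real ^ 'k ^ 'k" where
  "block1 X = (\<chi> i j. X $ Inl i $ Inl j)"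

definition block0 :: "real ^ ('k::finite + 'l::finite) ^ ('k + 'l) \<Rightarrow> real ^ 'l ^ 'k" where
  "block0 X = (\<chi> i j. X $ Inl i $ Inr j)"

definition block2 :: "real ^ ('k::finite + 'l::finite) ^ ('k + 'l) \<Rightarrow> real ^ 'l ^ 'l" where
  "block2 X = (\<chi> i j. X $ Inr i $ Inr j)"

definition scaling_cost ::
    "real ^ ('k::finite + 'l::finite) ^ ('k + 'l) \<Rightarrow> real ^ ('k + 'l) ^ ('k + 'l) \<Rightarrow> real \<times> real \<Rightarrow> real"
where
  "scaling_cost X \<Lambda> = (\<lambda>(\<gamma>1, \<gamma>2).
     \<gamma>1 / \<gamma>2 * (norm (block1 X))^2 + \<gamma>2 / \<gamma>1 * (norm (block1 \<Lambda>))^2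
     + \<gamma>1 * \<gamma>2 * (norm (block2 X))^2 + 1 / (\<gamma>1 * \<gamma>2) * (norm (block2 \<Lambda>))^2
     + 2 * \<gamma>1 * (norm (block0 X))^2 + 2 / \<gamma>1 * (norm (block0 \<Lambda>))^2)"

definition scaling_solution ::
    "real ^ ('k::finite + 'l::finite) ^ ('k + 'l) \<Rightarrow> real ^ ('k + 'l) ^ ('k + 'l) \<Rightarrow> real \<times> real \<Rightarrow> bool"
where
  "scaling_solution X \<Lambda> = is_arg_min (scaling_cost X \<Lambda>) (\<lambda>(\<gamma>1, \<gamma>2). 0 < \<gamma>1 \<and> 0 < \<gamma>2)"

text \<open>Coefficients are listed from the constant term upwards.\<close>

definition scaling_poly ::
    "real ^ ('k::finite + 'l::finite) ^ ('k + 'l) \<Rightarrow> real ^ ('k + 'l) ^ ('k + 'l) \<Rightarrow> real poly"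
where
  "scaling_poly X \<Lambda> =
     [: - ((norm (block2 \<Lambda>))^2 * (norm (block1 X))^2),
        - ((norm (block2 \<Lambda>))^2 * (norm (block0 X))^2 + (norm (block0 \<Lambda>))^2 * (norm (block1 X))^2),
        0,
        (norm (block2 X))^2 * (norm (block0 \<Lambda>))^2 + (norm (block0 X))^2 * (norm (block1 \<Lambda>))^2,
        (norm (block2 X))^2 * (norm (block1 \<Lambda>))^2 :]"

end

theory Submission
  imports Defs
begin

text \<open>
  Write \<open>x1, x0, x2\<close> and \<open>l1, l0, l2\<close> for the squared norms of the blocks of \<open>X\<close> and \<open>\<Lambda>\<close>.
  The cost separates as \<open>\<gamma>1 * P \<gamma>2 + Q \<gamma>2 / \<gamma>1\<close> with
  \<open>P t = x1 / t + t * x2 + 2 * x0\<close> and \<open>Q t = t * l1 + l2 / t + 2 * l0\<close>.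
  For fixed \<open>\<gamma>2\<close> the arithmetic-geometric mean inequality leaves exactly one minimizer
  \<open>\<gamma>1 = sqrt (Q \<gamma>2 / P \<gamma>2)\<close>, with value \<open>2 * sqrt (P \<gamma>2 * Q \<gamma>2)\<close>, so the problem reduces to
  minimizing the product \<open>P * Q\<close> over the positive reals.

  That product is a combination of \<open>t\<^sup>2\<close>, \<open>t\<close>, \<open>1 / t\<close>, \<open>1 / t\<^sup>2\<close> and a constant with nonnegative
  coefficients; it is strictly convex, and the quartic is its derivative multiplied by \<open>t ^ 3 / 2\<close>.
  A positive root \<open>u\<close> of the quartic is thus a critical point, hence a strict global minimizer of
  \<open>P * Q\<close> (lemma \<open>profile_less\<close>).  This also shows that there is at most one positive root. One exists
  because the quartic is negative at \<open>0\<close> and has a positive leading coefficient.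

  The four diagonal blocks being nonzero makes \<open>P\<close> and \<open>Q\<close> positive and the convexity strict.
\<close>

locale scaling_weights =
  fixes x1 x0 x2 l1 l0 l2 :: real
  assumes x1_pos: "0 < x1" and x2_pos: "0 < x2" and l1_pos: "0 < l1" and l2_pos: "0 < l2"
    and x0_nonneg: "0 \<le> x0" and l0_nonneg: "0 \<le> l0"
begin

definition P :: "real \<Rightarrow> real" where
  "P t = 1 / t * x1 + t * x2 + 2 * x0"

definition Q :: "real \<Rightarrow> real" where
  "Q t = t * l1 + 1 / t * l2 + 2 * l0"

definition cost :: "real \<Rightarrow> real \<Rightarrow> real" where
  "cost g t = g / t * x1 + t / g * l1 + g * t * x2 + 1 / (g * t) * l2 + 2 * g * x0 + 2 / g * l0"

definition quartic :: "real poly" where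
  "quartic = [: - (l2 * x1), - (l2 * x0 + l0 * x1), 0, x2 * l0 + x0 * l1, x2 * l1 :]"

definition optimal_g :: "real \<Rightarrow> real" where
  "optimal_g t = sqrt (Q t / P t)"

lemma P_pos: "0 < t \<Longrightarrow> 0 < P t"
  unfolding P_def using x1_pos x2_pos x0_nonneg by (intro add_pos_nonneg add_pos_pos) auto

lemma Q_pos: "0 < t \<Longrightarrow> 0 < Q t"
  unfolding Q_def using l1_pos l2_pos l0_nonneg by (intro add_pos_nonneg add_pos_pos) auto

lemma optimal_g_pos: "0 < t \<Longrightarrow> 0 < optimal_g t"
  unfolding optimal_g_def using P_pos Q_pos by simp

lemma degree_quartic: "degree quartic = 4"
  unfolding quartic_def using x2_pos l1_pos by simp

text \<open>Completing the square in \<open>g\<close>: with \<open>s = optimal_g t\<close> one has \<open>Q t = s\<^sup>2 * P t\<close>, and the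
  first summand on the right is \<open>2 * s * P t\<close>.\<close>

lemma cost_eq_profile_plus_square:
  assumes "0 < g" "0 < t"
  shows "cost g t = 2 * sqrt (P t * Q t) + P t * (g - optimal_g t)^2 / g"
proof -
  let ?s = "optimal_g t"
  have P: "0 < P t" and Q: "0 < Q t" using P_pos Q_pos assms by auto
  have Qs: "Q t = ?s^2 * P t" using P Q by (simp add: optimal_g_def)
  have "sqrt (P t * Q t) = sqrt ((?s * P t)^2)" by (simp add: Qs power2_eq_square mult_ac)
  also have "\<dots> = ?s * P t" using P optimal_g_pos[OF assms(2)] by simp
  finally have sq: "sqrt (P t * Q t) = ?s * P t" .
  have "cost g t = g * P t + Q t / g"
    using assms by (simp add: cost_def P_def Q_def field_simps power2_eq_square)
  also have "\<dots> = 2 * (?s * P t) + P t * (g - ?s)^2 / g"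
    using assms(1) by (simp add: Qs field_simps power2_eq_square)
  finally show ?thesis by (simp add: sq)
qed

text \<open>
  Subtracting from each term of \<open>P * Q\<close> its tangent at \<open>u\<close> leaves a nonnegative multiple of
  \<open>(t - u)\<^sup>2\<close>; the tangents add up to a multiple of \<open>poly quartic u\<close>, the last summand below.
\<close>

lemma profile_expansion:
  assumes "0 < t" "0 < u"
  shows "P t * Q t = P u * Q u
    + (t - u)^2 * (x2 * l1 + 2 * (l2 * x0 + l0 * x1) / (t * u^2) + l2 * x1 * (2 * t + u) / (t^2 * u^3))
    + 2 * (t - u) / u^3 * poly quartic u"
  using assms by (simp add: P_def Q_def quartic_def divide_simps) algebra

lemma profile_less:
  assumes "0 < t" "0 < u" "poly quartic u = 0" "t \<noteq> u"
  shows "P u * Q u < P t * Q t"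
proof -
  have "0 < x2 * l1" "0 \<le> 2 * (l2 * x0 + l0 * x1) / (t * u^2)"
      "0 \<le> l2 * x1 * (2 * t + u) / (t^2 * u^3)"
    using assms x1_pos x2_pos l1_pos l2_pos x0_nonneg l0_nonneg by auto
  then have "0 < (t - u)^2 * (x2 * l1 + 2 * (l2 * x0 + l0 * x1) / (t * u^2)
      + l2 * x1 * (2 * t + u) / (t^2 * u^3))"
    using assms(4) by (intro mult_pos_pos) auto
  then show ?thesis using profile_expansion[OF assms(1,2)] assms(3) by simp
qed

lemma quartic_ex1_pos_root: "\<exists>!u. 0 < u \<and> poly quartic u = 0"
proof -
  have lc: "0 < lead_coeff quartic"
    using x2_pos l1_pos degree_quartic by (simp add: quartic_def numeral_eq_Suc)
  then obtain n where n: "\<And>y. n \<le> y \<Longrightarrow> lead_coeff quartic \<le> poly quartic y"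
    using poly_pinfty_gt_lc by blast
  have "0 < poly quartic (max n 1)" using lc n[of "max n 1"] by simp
  moreover have "poly quartic 0 < 0" using x1_pos l2_pos by (simp add: quartic_def)
  ultimately obtain u where "0 < u" "poly quartic u = 0"
    using poly_IVT_pos[of 0 "max n 1" quartic] by (meson less_max_iff_disj zero_less_one)
  moreover have "v = u" if "0 < u" "poly quartic u = 0" "0 < v" "poly quartic v = 0" for u v
    using profile_less[of u v] profile_less[of v u] that by force
  ultimately show ?thesis by blast
qed

lemma cost_less:
  assumes "0 < g" "0 < t" "0 < u" "poly quartic u = 0" "(g, t) \<noteq> (optimal_g u, u)"
  shows "cost (optimal_g u) u < cost g t"
proof -
  have opt: "cost (optimal_g u) u = 2 * sqrt (P u * Q u)"
    using cost_eq_profile_plus_square[OF optimal_g_pos assms(3)] assms(3) by simp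
  have cost: "cost g t = 2 * sqrt (P t * Q t) + P t * (g - optimal_g t)^2 / g"
    using cost_eq_profile_plus_square assms by blast
  show ?thesis
  proof (cases "t = u")
    case True
    then have "0 < P t * (g - optimal_g t)^2 / g" using assms P_pos by simp
    then show ?thesis using opt cost True by simp
  next
    case False
    then have "sqrt (P u * Q u) < sqrt (P t * Q t)" using profile_less assms by simp
    moreover have "0 \<le> P t * (g - optimal_g t)^2 / g" using assms P_pos[of t] by simp
    ultimately show ?thesis using opt cost by linarith
  qed
qed

lemma is_arg_min_cost_iff:
  assumes "0 < u" "poly quartic u = 0"
  shows "is_arg_min (\<lambda>(g, t). cost g t) (\<lambda>(g, t). 0 < g \<and> 0 < t) \<gamma> \<longleftrightarrow> \<gamma> = (optimal_g u, u)"
proof -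
  have "cost (optimal_g u) u < cost g t" if "0 < g" "0 < t" "(g, t) \<noteq> (optimal_g u, u)" for g t
    using cost_less assms that by blast
  then show ?thesis
    using assms optimal_g_pos[OF assms(1)]
    by (cases \<gamma>) (fastforce simp: is_arg_min_def)
qed

end

theorem proposition4p2:
  fixes A0 :: "real ^ ('k::finite + 'l::finite) ^ ('k + 'l)"
    and A :: "'m::finite \<Rightarrow> real ^ ('k + 'l) ^ ('k + 'l)"
    and c :: "real ^ 'm"
    and x :: "real ^ 'm"
    and U X \<Lambda> :: "real ^ ('k + 'l) ^ ('k + 'l)"
  assumes "A0 \<in> sym_mats" and "\<And>i. A i \<in> sym_mats"
    and "primal_dual_pair (primal_form_f c) (primal_form_map A0 A) x \<Lambda> \<and> X = primal_form_map A0 A x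
       \<or> primal_dual_pair (dual_form_f A0 A c) dual_form_map U \<Lambda> \<and> X = dual_form_map U"
    and "block1 X \<noteq> 0" and "block2 X \<noteq> 0" and "block1 \<Lambda> \<noteq> 0" and "block2 \<Lambda> \<noteq> 0"
  shows "(\<exists>!\<gamma>. scaling_solution X \<Lambda> \<gamma>)
    \<and> degree (scaling_poly X \<Lambda>) = 4
    \<and> (\<exists>!t. 0 < t \<and> poly (scaling_poly X \<Lambda>) t = 0)
    \<and> (\<forall>\<gamma>1 \<gamma>2. scaling_solution X \<Lambda> (\<gamma>1, \<gamma>2) \<longrightarrow>
          0 < \<gamma>2 \<and> poly (scaling_poly X \<Lambda>) \<gamma>2 = 0
        \<and> \<gamma>1 = sqrt ((\<gamma>2 * (norm (block1 \<Lambda>))^2 + 1 / \<gamma>2 * (norm (block2 \<Lambda>))^2 + 2 * (norm (block0 \<Lambda>))^2)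
                   / (1 / \<gamma>2 * (norm (block1 X))^2 + \<gamma>2 * (norm (block2 X))^2 + 2 * (norm (block0 X))^2)))"
proof -
  interpret W: scaling_weights "(norm (block1 X))^2" "(norm (block0 X))^2" "(norm (block2 X))^2"
      "(norm (block1 \<Lambda>))^2" "(norm (block0 \<Lambda>))^2" "(norm (block2 \<Lambda>))^2"
    using assms by unfold_locales auto
  have quartic: "scaling_poly X \<Lambda> = W.quartic"
    by (simp add: scaling_poly_def W.quartic_def)
  obtain u where u: "0 < u" "poly W.quartic u = 0"
    using W.quartic_ex1_pos_root by blast
  have sol: "scaling_solution X \<Lambda> \<gamma> \<longleftrightarrow> \<gamma> = (W.optimal_g u, u)" for \<gamma>
    using W.is_arg_min_cost_iff[OF u]
    by (simp add: scaling_solution_def scaling_cost_def W.cost_def)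
  show ?thesis
    using u sol W.degree_quartic W.quartic_ex1_pos_root
    unfolding quartic by (auto simp: W.optimal_g_def W.P_def W.Q_def)
qed

end
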